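(* Let $n>2$ and let $m_1>m_2>\cdots>m_n>0$ and $1+r>0$ be real numbers. Suppose $m_{s-1}>1+r\ge m_s$ for some $s\in\{2,\ldots,n\}$ and $1+r\neq m_n$, and let $I=\{1,\ldots,s-1\}$ and $J=\{s,\ldots,n\}$. Let $\mathcal{Q}$ be the set of equivalent martingale measures of the one-period $n$-nomial market model with parameters $m_1,\ldots,m_n$ and $1+r$. Then the set of extreme points of the closure $\mathrm{cl}(\mathcal{Q})$ is $$\mathrm{ext}(\mathrm{cl}(\mathcal{Q}))=\{Q_{i,j}\,:\,(i,j)\in I\times J\},$$ where, for $(i,j)\in I\times J$, $Q_{i,j}$ is the probability measure on $\{1,\ldots,n\}$ identified with the vector $(0,\ldots,0,q_i,0,\ldots,0,q_j,0,\ldots,0)^T$ whose $i$-th and $j$-th entries are $$q_i=\frac{(1+r)-m_j}{m_i-m_j},\qquad q_j=\frac{m_i-(1+r)}{m_i-m_j},$$ and whose other entries are $0$.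
   Context: One-period $n$-nomial market model: $\Omega=\{1,\ldots,n\}$, $\mathcal{F}$ is the power set of $\Omega$, and $P$ is a probability measure on $\mathcal{F}$ with $P(\{i\})>0$ for all $i\in\Omega$. There is a risk-free asset with $B_0=1$, $B_1=1+r>0$, and a risky asset with price $S_0>0$ at time $0$ and price $S_1(i)=m_iS_0$, $i\in\Omega$, at time $1$, where $m_1>\cdots>m_n>0$. A probability measure $Q$ on $\mathcal{F}$ is identified with the vector $(q_1,\ldots,q_n)^T\in[0,1]^n$, $q_i=Q(\{i\})$. The set of equivalent martingale measures is $$\mathcal{Q}=\{Q \text{ probability measure on }\mathcal{F}\,:\,(1+r)^{-1}\mathbb{E}_Q(S_1)=S_0,\ Q\sim P\},$$ where $Q\sim P$ means that $Q$ and $P$ have the same null sets (i.e. $q_i>0$ for all $i$). $\mathrm{cl}(\mathcal{Q})$ denotes the closure of $\mathcal{Q}$ (in $\mathbb{R}^n$, equivalently in the product topology), and $\mathrm{ext}$ denotes the set of extreme points of a convex set. *)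

theory Defs
  imports "HOL-Probability.Probability"
begin

definition prob_measures :: "nat \<Rightarrow> nat measure set" where
  "prob_measures n = {Q. prob_space Q \<and> sets Q = Pow {1..n}}"

definition equiv_measures :: "'a measure \<Rightarrow> 'a measure \<Rightarrow> bool" where
  "equiv_measures Q P \<longleftrightarrow> null_sets Q = null_sets P"

definition stock_price :: "real \<Rightarrow> (nat \<Rightarrow> real) \<Rightarrow> nat \<Rightarrow> real" where
  "stock_price S0 m i = m i * S0"

text \<open>Equivalent martingale measures of the one-period model on the outcomes \<open>{1..n}\<close> with
  physical measure \<open>P\<close>, initial price \<open>S0\<close>, price relatives \<open>m\<close> and interest rate \<open>r\<close>.\<close>

definition emm :: "nat \<Rightarrow> nat measure \<Rightarrow> real \<Rightarrow> (nat \<Rightarrow> real) \<Rightarrow> real \<Rightarrow> nat measure set" where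
  "emm n P S0 m r = {Q \<in> prob_measures n.
     inverse (1 + r) * integral\<^sup>L Q (stock_price S0 m) = S0 \<and> equiv_measures Q P}"

text \<open>Vectors in \<open>\<real>\<^sup>n\<close> are elements of \<open>real ^ 'n\<close>; a bijection \<open>\<iota>\<close> from the index type \<open>'n\<close> onto
  \<open>{1..n}\<close> tells which outcome each coordinate belongs to.\<close>

definition prob_vec :: "('n::finite \<Rightarrow> nat) \<Rightarrow> nat measure \<Rightarrow> real ^ 'n" where
  "prob_vec \<iota> Q = (\<chi> k. measure Q {\<iota> k})"

definition q_vec :: "('n::finite \<Rightarrow> nat) \<Rightarrow> (nat \<Rightarrow> real) \<Rightarrow> real \<Rightarrow> nat \<Rightarrow> nat \<Rightarrow> real ^ 'n" where
  "q_vec \<iota> m r i j = (\<chi> k.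
     if \<iota> k = i then ((1 + r) - m j) / (m i - m j)
     else if \<iota> k = j then (m i - (1 + r)) / (m i - m j)
     else 0)"

end

theory Submission
  imports Defs
begin

text \<open>Identifying measures with their weights, the equivalent martingale measures become the
  strictly positive points of the polytope \<open>K\<close> of martingale weights, and \<open>K\<close> is their closure,
  since any segment from a strictly positive point consists, up to its other end, of such points.
  An extreme point of \<open>K\<close> is determined by its support: if the support of \<open>q \<in> K\<close> is contained in
  the support of an extreme point \<open>x\<close>, then a small multiple of \<open>q\<close> can be split off from \<open>x\<close>, so
  \<open>x = q\<close>. The martingale condition forces every point of \<open>K\<close> to have the support of some \<open>Q\<^sub>i\<^sub>j\<close>
  inside its own; conversely \<open>Q\<^sub>i\<^sub>j\<close> is the only point of \<open>K\<close> supported in \<open>{i, j}\<close>.\<close>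

section \<open>The polytope of martingale weights and its two-point elements\<close>

definition mart_weights :: "('n::finite \<Rightarrow> real) \<Rightarrow> real \<Rightarrow> (real ^ 'n) set" where
  "mart_weights a R = {x. (\<forall>k. 0 \<le> x $ k) \<and> (\<Sum>k\<in>UNIV. x $ k) = 1 \<and> (\<Sum>k\<in>UNIV. a k * x $ k) = R}"

text \<open>The coordinate form of \<open>q_vec\<close>: outcomes are replaced by elements of the
  index type and the price relatives by an arbitrary function \<open>a\<close>, so that the convex
  geometry can be done without mentioning measures.\<close>

definition two_point :: "('n::finite \<Rightarrow> real) \<Rightarrow> real \<Rightarrow> 'n \<Rightarrow> 'n \<Rightarrow> real ^ 'n" where
  "two_point a R i j = (\<chi> k. if k = i then (R - a j) / (a i - a j)
     else if k = j then (a i - R) / (a i - a j) else 0)"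

lemma mart_weightsD:
  assumes "x \<in> mart_weights a R"
  shows "0 \<le> x $ k" "(\<Sum>k\<in>UNIV. x $ k) = 1" "(\<Sum>k\<in>UNIV. a k * x $ k) = R"
  using assms by (auto simp: mart_weights_def)

lemma mart_weights_le_1:
  assumes "x \<in> mart_weights a R"
  shows "x $ k \<le> 1"
  using member_le_sum[of k UNIV "\<lambda>k. x $ k"] mart_weightsD[OF assms] by simp

lemma sum_two_support:
  fixes f :: "'n::finite \<Rightarrow> real"
  assumes "i \<noteq> j" "\<And>k. k \<noteq> i \<Longrightarrow> k \<noteq> j \<Longrightarrow> f k = 0"
  shows "(\<Sum>k\<in>UNIV. f k) = f i + f j"
proof -
  have "(\<Sum>k\<in>UNIV. f k) = (\<Sum>k\<in>{i, j}. f k)"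
    using assms(2) by (intro sum.mono_neutral_right) auto
  then show ?thesis using assms(1) by simp
qed

lemma two_point_in_mart_weights:
  assumes "R < a i" "a j \<le> R"
  shows "two_point a R i j \<in> mart_weights a R"
proof -
  have ij: "i \<noteq> j" using assms by auto
  let ?q = "two_point a R i j"
  have 1: "(\<Sum>k\<in>UNIV. ?q $ k) = ?q $ i + ?q $ j"
    by (rule sum_two_support[OF ij]) (simp add: two_point_def)
  have 2: "(\<Sum>k\<in>UNIV. a k * ?q $ k) = a i * ?q $ i + a j * ?q $ j"
    by (rule sum_two_support[OF ij]) (simp add: two_point_def)
  have "?q $ i + ?q $ j = 1" "a i * ?q $ i + a j * ?q $ j = R"
    using assms ij by (simp_all add: two_point_def divide_simps) (simp_all add: algebra_simps)
  moreover have "\<forall>k. 0 \<le> ?q $ k"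
    using assms by (simp add: two_point_def)
  ultimately show ?thesis by (simp only: mart_weights_def mem_Collect_eq 1 2) simp
qed

text \<open>Total mass and mean give two linear equations in \<open>x $ i\<close> and
  \<open>x $ j\<close>; their determinant is, up to sign, \<open>a i - a j\<close>, which is
  positive, so the solution is unique.\<close>

lemma mart_weights_two_support:
  assumes x: "x \<in> mart_weights a R" and "R < a i" "a j \<le> R"
    and supp: "\<And>k. k \<noteq> i \<Longrightarrow> k \<noteq> j \<Longrightarrow> x $ k = 0"
  shows "x = two_point a R i j"
proof -
  have ij: "i \<noteq> j" using assms by auto
  have s: "x $ i + x $ j = 1"
    using sum_two_support[OF ij, of "\<lambda>k. x $ k"] supp mart_weightsD(2)[OF x] by simp
  have m: "a i * x $ i + a j * x $ j = R"
    using sum_two_support[OF ij, of "\<lambda>k. a k * x $ k"] supp mart_weightsD(3)[OF x] by simp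
  have xj: "x $ j = 1 - x $ i" using s by simp
  have "x $ i * (a i - a j) = R - a j"
    using m unfolding xj by (simp add: algebra_simps)
  moreover have "x $ j * (a i - a j) = a i - R"
    using m unfolding xj by (simp add: algebra_simps)
  ultimately have "x $ i = (R - a j) / (a i - a j)" "x $ j = (a i - R) / (a i - a j)"
    using assms by (simp_all add: eq_divide_eq)
  then show ?thesis using supp by (auto simp: two_point_def vec_eq_iff)
qed

lemma convex_mart_weights: "convex (mart_weights a R)"
proof (rule convexI)
  fix x y and u v :: real
  assume x: "x \<in> mart_weights a R" and y: "y \<in> mart_weights a R"
    and uv: "0 \<le> u" "0 \<le> v" "u + v = 1"
  note X = mart_weightsD[OF x] and Y = mart_weightsD[OF y]
  have "(\<Sum>k\<in>UNIV. u * x $ k + v * y $ k) = u * (\<Sum>k\<in>UNIV. x $ k) + v * (\<Sum>k\<in>UNIV. y $ k)"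
    by (simp add: sum.distrib sum_distrib_left)
  moreover have "(\<Sum>k\<in>UNIV. a k * (u * x $ k + v * y $ k))
      = u * (\<Sum>k\<in>UNIV. a k * x $ k) + v * (\<Sum>k\<in>UNIV. a k * y $ k)"
    by (simp add: sum.distrib sum_distrib_left algebra_simps)
  moreover have "u * R + v * R = R"
    using uv(3) by (metis distrib_right mult_1)
  ultimately show "u *\<^sub>R x + v *\<^sub>R y \<in> mart_weights a R"
    using X Y uv by (simp add: mart_weights_def)
qed

lemma closed_mart_weights: "closed (mart_weights a R)"
  unfolding mart_weights_def
  by (intro closed_Collect_conj closed_Collect_all closed_Collect_le closed_Collect_eq
      continuous_intros)

section \<open>Extreme points of the polytope\<close>

lemma extreme_mart_weights_eq_of_support:
  assumes ext: "x extreme_point_of mart_weights a R" and q: "q \<in> mart_weights a R"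
    and supp: "\<And>k. 0 < q $ k \<Longrightarrow> 0 < x $ k"
  shows "x = q"
proof -
  have x: "x \<in> mart_weights a R" using ext by (simp add: extreme_point_of_def)
  note X = mart_weightsD[OF x] and Q = mart_weightsD[OF q]
  \<comment> \<open>Half the smallest positive entry of \<open>x\<close>, with 1 inserted to keep
    \<open>t\<close> below 1. Entries of \<open>q\<close> are at most 1, so \<open>t * q $ k\<close>
    stays below \<open>x $ k\<close> wherever \<open>q\<close> is positive.\<close>
  define t where "t = Min (insert 1 ((\<lambda>k. x $ k) ` {k. 0 < x $ k})) / 2"
  have t0: "0 < t" unfolding t_def by (simp add: Min_gr_iff)
  have t1: "t < 1"
  proof -
    have "Min (insert 1 ((\<lambda>k. x $ k) ` {k. 0 < x $ k})) \<le> 1" by (intro Min_le) auto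
    then show ?thesis unfolding t_def by linarith
  qed
  have tq: "t * q $ k \<le> x $ k" for k
  proof (cases "0 < q $ k")
    case True
    then have "Min (insert 1 ((\<lambda>k. x $ k) ` {k. 0 < x $ k})) \<le> x $ k"
      using supp by (intro Min_le) auto
    then have "t \<le> x $ k" using t0 unfolding t_def by linarith
    moreover have "t * q $ k \<le> t" using t0 mart_weights_le_1[OF q, of k] by simp
    ultimately show ?thesis by simp
  next
    case False
    then have "q $ k = 0" using Q(1)[of k] by simp
    then show ?thesis using X(1) by simp
  qed
  \<comment> \<open>What is left of \<open>x\<close> after splitting off
    \<open>t *\<^sub>R q\<close>, rescaled to total mass 1. Then \<open>x\<close> is a proper convex
    combination of \<open>y\<close> and \<open>q\<close>, which extremality allows only if
    \<open>y = q\<close>.\<close>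
  define y where "y = (1 / (1 - t)) *\<^sub>R (x - t *\<^sub>R q)"
  have xy: "x = (1 - t) *\<^sub>R y + t *\<^sub>R q" using t1 by (simp add: y_def)
  have y: "y \<in> mart_weights a R"
  proof -
    have "\<forall>k. 0 \<le> y $ k" using tq t1 by (simp add: y_def)
    moreover have "(\<Sum>k\<in>UNIV. y $ k) = 1"
      using X Q t1 by (simp add: y_def sum_subtractf flip: sum_divide_distrib sum_distrib_left)
    moreover have "(\<Sum>k\<in>UNIV. a k * y $ k) = R"
    proof -
      have "(\<Sum>k\<in>UNIV. a k * y $ k)
          = ((\<Sum>k\<in>UNIV. a k * x $ k) - t * (\<Sum>k\<in>UNIV. a k * q $ k)) / (1 - t)"
        by (simp add: y_def sum_subtractf sum_distrib_left sum_divide_distrib right_diff_distrib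
            diff_divide_distrib mult.left_commute)
      also have "\<dots> = (R * (1 - t)) / (1 - t)" using X Q by (simp add: algebra_simps)
      finally show ?thesis using t1 by simp
    qed
    ultimately show ?thesis by (simp add: mart_weights_def)
  qed
  show ?thesis
  proof (cases "y = q")
    case True
    then show ?thesis using xy by (simp flip: scaleR_left_distrib)
  next
    case False
    then have "x \<in> open_segment y q" using xy t0 t1 by (auto simp: in_segment)
    then show ?thesis using ext y q by (auto simp: extreme_point_of_def)
  qed
qed

text \<open>Entries are nonnegative, so where a proper convex combination vanishes both of its ends
  vanish. Hence both ends of a segment through the point are supported in \<open>{i, j}\<close> and
  coincide with it.\<close>

lemma two_point_extreme:
  assumes "R < a i" "a j \<le> R"
  shows "two_point a R i j extreme_point_of mart_weights a R"
  unfolding extreme_point_of_def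
proof (intro conjI ballI notI)
  show "two_point a R i j \<in> mart_weights a R" by (rule two_point_in_mart_weights[OF assms])
  fix y z assume y: "y \<in> mart_weights a R" and z: "z \<in> mart_weights a R"
    and seg: "two_point a R i j \<in> open_segment y z"
  from seg obtain t where t: "y \<noteq> z" "0 < t" "t < 1"
    and eq: "two_point a R i j = (1 - t) *\<^sub>R y + t *\<^sub>R z" by (auto simp: in_segment)
  have "y $ k = 0 \<and> z $ k = 0" if "k \<noteq> i" "k \<noteq> j" for k
  proof -
    have "0 = (1 - t) * y $ k + t * z $ k"
      using arg_cong[OF eq, of "\<lambda>x. x $ k"] that by (simp add: two_point_def)
    moreover have "0 \<le> (1 - t) * y $ k" "0 \<le> t * z $ k"
      using mart_weightsD(1)[OF y] mart_weightsD(1)[OF z] t by simp_all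
    ultimately have "(1 - t) * y $ k = 0" "t * z $ k = 0" by linarith+
    then show ?thesis using t by simp
  qed
  then have "y = two_point a R i j" "z = two_point a R i j"
    using mart_weights_two_support assms y z by blast+
  then show False using t by simp
qed

text \<open>The deviation \<open>a k - R\<close> has mean zero under \<open>x\<close>. Mass above
  \<open>R\<close> therefore forces mass below \<open>R\<close>, which yields the pair; without mass
  above, all mass lies on the level \<open>R\<close> itself.\<close>

lemma mart_weights_support_contains_two_point:
  assumes x: "x \<in> mart_weights a R" and above: "R < a l"
  obtains i j where "R < a i" "a j \<le> R" "\<And>k. 0 < two_point a R i j $ k \<Longrightarrow> 0 < x $ k"
proof -
  note X = mart_weightsD[OF x]
  have excess: "(\<Sum>k\<in>UNIV. (a k - R) * x $ k) = 0"
    using X by (simp add: left_diff_distrib sum_subtractf flip: sum_distrib_left)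
  show ?thesis
  proof (cases "\<exists>i. R < a i \<and> 0 < x $ i")
    case True
    then obtain i where i: "R < a i" "0 < x $ i" by blast
    have "\<exists>j. (a j - R) * x $ j < 0"
    proof (rule ccontr)
      assume "\<not> ?thesis"
      then have "0 < (\<Sum>k\<in>UNIV. (a k - R) * x $ k)"
        using i by (intro sum_pos2[of _ i]) (auto simp: not_less)
      then show False using excess by simp
    qed
    then obtain j where j: "(a j - R) * x $ j < 0" by blast
    then have "a j < R" "0 < x $ j" using X(1)[of j] by (auto simp: mult_less_0_iff)
    with i show ?thesis
      by (intro that[of i j]) (auto simp: two_point_def split: if_splits)
  next
    case False
    then have pos: "a k \<le> R" if "0 < x $ k" for k using that by (meson not_less)
    have "\<exists>k. x $ k \<noteq> 0"
      using X(2) by (metis sum.neutral zero_neq_one)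
    then obtain k where k: "0 < x $ k" using X(1) by (metis less_le)
    \<comment> \<open>With no mass above \<open>R\<close> these terms are nonnegative for every
      \<open>k\<close>, and they sum to zero.\<close>
    have "(R - a k) * x $ k = 0"
    proof -
      have "(\<Sum>k\<in>UNIV. (R - a k) * x $ k) = 0"
        using X by (simp add: left_diff_distrib sum_subtractf flip: sum_distrib_left)
      moreover have "0 \<le> (R - a k) * x $ k" for k
        using X(1)[of k] pos[of k] by (cases "x $ k = 0") auto
      ultimately show ?thesis using sum_nonneg_eq_0_iff[of UNIV "\<lambda>k. (R - a k) * x $ k"] by simp
    qed
    then have "a k = R" using k by simp
    \<comment> \<open>Since \<open>a k = R\<close>, the vector \<open>two_point a R l k\<close>
      degenerates to the unit mass at \<open>k\<close>: its entry at \<open>l\<close> is 0, so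
      \<open>x $ l\<close> may vanish. The coordinate \<open>l\<close> above \<open>R\<close> only
      supplies the partner.\<close>
    with k above show ?thesis
      by (intro that[of l k]) (auto simp: two_point_def split: if_splits)
  qed
qed

theorem extreme_points_mart_weights:
  assumes "R < a l"
  shows "{x. x extreme_point_of mart_weights a R} = {two_point a R i j | i j. R < a i \<and> a j \<le> R}"
proof (intro equalityI subsetI; clarify)
  fix x assume ext: "x extreme_point_of mart_weights a R"
  then have "x \<in> mart_weights a R" by (simp add: extreme_point_of_def)
  from mart_weights_support_contains_two_point[OF this assms]
  obtain i j where "R < a i" "a j \<le> R" "\<And>k. 0 < two_point a R i j $ k \<Longrightarrow> 0 < x $ k" by blast
  then show "\<exists>i j. x = two_point a R i j \<and> R < a i \<and> a j \<le> R"
    using extreme_mart_weights_eq_of_support[OF ext two_point_in_mart_weights] by blast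
next
  fix i j assume "R < a i" "a j \<le> R"
  then show "two_point a R i j extreme_point_of mart_weights a R" by (rule two_point_extreme)
qed

section \<open>Density of the strictly positive weights\<close>

lemma exists_positive_mart_weights:
  fixes a :: "'n::finite \<Rightarrow> real"
  assumes hi: "R < a h" and lo: "a l < R"
  shows "\<exists>u \<in> mart_weights a R. \<forall>k. 0 < u $ k"
proof -
  \<comment> \<open>Each \<open>k\<close> is paired with a coordinate on the other side of
    \<open>R\<close>: with \<open>l\<close> if \<open>a k\<close> exceeds \<open>R\<close>,
    otherwise with \<open>h\<close>. The weight at \<open>k\<close> is positive because the
    partner's value differs strictly from \<open>R\<close>.\<close>
  have "\<exists>v \<in> mart_weights a R. 0 < v $ k" for k
  proof (cases "R < a k")
    case True
    then show ?thesis using lo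
      by (intro bexI[of _ "two_point a R k l"] two_point_in_mart_weights)
        (auto simp: two_point_def)
  next
    case False
    then show ?thesis using hi
      by (intro bexI[of _ "two_point a R h k"] two_point_in_mart_weights)
        (auto simp: two_point_def)
  qed
  then obtain v where v: "\<And>k. v k \<in> mart_weights a R" "\<And>k. 0 < v k $ k" by metis
  \<comment> \<open>The uniform average of the \<open>v k\<close> inherits positivity at each
    \<open>k\<close> from its summand \<open>v k\<close>.\<close>
  define u where "u = (\<Sum>k\<in>UNIV. (1 / real CARD('n)) *\<^sub>R v k)"
  have "u \<in> mart_weights a R"
    unfolding u_def by (rule convex_sum[OF _ convex_mart_weights]) (use v in auto)
  moreover have "0 < u $ k" for k
    unfolding u_def sum_component
    by (rule sum_pos2[of _ k]) (use v mart_weightsD(1)[OF v(1)] in auto)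
  ultimately show ?thesis by blast
qed

lemma closure_positive_mart_weights:
  assumes "R < a h" "a l < R"
  shows "closure {x \<in> mart_weights a R. \<forall>k. 0 < x $ k} = mart_weights a R" (is "closure ?U = ?K")
proof
  show "closure ?U \<subseteq> ?K" by (rule closure_minimal[OF _ closed_mart_weights]) auto
  obtain u where u: "u \<in> ?K" "\<And>k. 0 < u $ k"
    using exists_positive_mart_weights[OF assms] by blast
  show "?K \<subseteq> closure ?U"
  proof
    fix x assume x: "x \<in> ?K"
    show "x \<in> closure ?U"
    \<comment> \<open>The open segment is empty if \<open>x = u\<close>. Otherwise it consists of
      strictly positive points, and its closure is the closed segment, which contains
      \<open>x\<close>.\<close>
    proof (cases "x = u")
      case True
      then show ?thesis using u by (intro subsetD[OF closure_subset]) simp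
    next
      case False
      have "open_segment x u \<subseteq> ?U"
      proof
        fix y assume y: "y \<in> open_segment x u"
        then obtain t where t: "0 < t" "t < 1" "y = (1 - t) *\<^sub>R x + t *\<^sub>R u"
          by (auto simp: in_segment)
        have "y \<in> ?K"
          using y x u(1) convex_mart_weights convex_contains_open_segment by blast
        moreover have "0 < y $ k" for k
          using t u(2)[of k] mart_weightsD(1)[OF x, of k] by (simp add: add_nonneg_pos)
        ultimately show "y \<in> ?U" by simp
      qed
      then have "closure (open_segment x u) \<subseteq> closure ?U" by (rule closure_mono)
      then show ?thesis using False by (auto simp: closure_open_segment)
    qed
  qed
qed

section \<open>Probability measures on \<open>{1..n}\<close> as weight vectors\<close>

lemma prob_measures_sum_singletons:
  assumes "Q \<in> prob_measures n"
  shows "(\<Sum>i\<in>{1..n}. measure Q {i}) = 1"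
proof -
  interpret prob_space Q using assms by (simp add: prob_measures_def)
  have sets: "sets Q = Pow {1..n}" using assms by (simp add: prob_measures_def)
  then have "space Q = {1..n}" using sets_eq_imp_space_eq[of Q "count_space {1..n}"] by simp
  then show ?thesis
    using prob_space finite_measure_eq_sum_singleton[of "{1..n}"] sets by auto
qed

lemma prob_measures_integral:
  fixes f :: "nat \<Rightarrow> real"
  assumes "Q \<in> prob_measures n"
  shows "integral\<^sup>L Q f = (\<Sum>i\<in>{1..n}. measure Q {i} * f i)"
proof -
  interpret prob_space Q using assms by (simp add: prob_measures_def)
  have sets: "sets Q = Pow {1..n}" using assms by (simp add: prob_measures_def)
  \<comment> \<open>On a finite set with all subsets measurable, a measure is determined by its
    values on singletons.\<close>
  have "Q = point_measure {1..n} (\<lambda>i. ennreal (measure Q {i}))"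
    by (rule measure_eqI_finite[of _ "{1..n}"])
      (simp_all add: sets sets_point_measure emeasure_point_measure_finite emeasure_eq_measure)
  then have "integral\<^sup>L Q f = integral\<^sup>L (point_measure {1..n} (\<lambda>i. ennreal (measure Q {i}))) f"
    by simp
  also have "\<dots> = (\<Sum>i\<in>{1..n}. measure Q {i} * f i)"
    by (subst lebesgue_integral_point_measure_finite) auto
  finally show ?thesis .
qed

lemma prob_measures_with_weights:
  fixes p :: "nat \<Rightarrow> real"
  assumes "\<And>i. i \<in> {1..n} \<Longrightarrow> 0 \<le> p i" "(\<Sum>i\<in>{1..n}. p i) = 1"
  shows "\<exists>Q \<in> prob_measures n. \<forall>i\<in>{1..n}. measure Q {i} = p i"
proof -
  let ?Q = "point_measure {1..n} (\<lambda>i. ennreal (p i))"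
  have "emeasure ?Q (space ?Q) = 1"
    using assms sum_ennreal[of "{1..n}" p]
    by (simp add: space_point_measure emeasure_point_measure_finite)
  then have "prob_space ?Q" by (rule prob_spaceI)
  moreover have "measure ?Q {i} = p i" if "i \<in> {1..n}" for i
    using that assms by (simp add: measure_def emeasure_point_measure_finite)
  ultimately show ?thesis
    by (intro bexI[of _ ?Q]) (auto simp: prob_measures_def sets_point_measure)
qed

lemma prob_vec_image_prob_measures:
  fixes \<iota> :: "'n::finite \<Rightarrow> nat"
  assumes \<iota>: "bij_betw \<iota> UNIV {1..n}"
  shows "prob_vec \<iota> ` prob_measures n = {x. (\<forall>k. 0 \<le> x $ k) \<and> (\<Sum>k\<in>UNIV. x $ k) = 1}"
proof (intro equalityI subsetI)
  fix x assume "x \<in> prob_vec \<iota> ` prob_measures n"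
  then obtain Q where Q: "Q \<in> prob_measures n" "x = prob_vec \<iota> Q" by blast
  then show "x \<in> {x. (\<forall>k. 0 \<le> x $ k) \<and> (\<Sum>k\<in>UNIV. x $ k) = 1}"
    using prob_measures_sum_singletons[OF Q(1)]
      sum.reindex_bij_betw[OF \<iota>, of "\<lambda>i. measure Q {i}"]
    by (simp add: prob_vec_def)
next
  fix x :: "real ^ 'n" assume x: "x \<in> {x. (\<forall>k. 0 \<le> x $ k) \<and> (\<Sum>k\<in>UNIV. x $ k) = 1}"
  have inv: "inv \<iota> (\<iota> k) = k" for k using \<iota> by (simp add: bij_betw_def)
  have "(\<Sum>i\<in>{1..n}. x $ inv \<iota> i) = 1"
    using x sum.reindex_bij_betw[OF \<iota>, of "\<lambda>i. x $ inv \<iota> i"] by (simp add: inv)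
  from prob_measures_with_weights[OF _ this] x
  obtain Q where Q: "Q \<in> prob_measures n" "\<forall>i\<in>{1..n}. measure Q {i} = x $ inv \<iota> i" by auto
  have "\<iota> k \<in> {1..n}" for k using \<iota> by (auto simp: bij_betw_def)
  then have "prob_vec \<iota> Q = x" using Q(2) by (simp add: prob_vec_def vec_eq_iff inv)
  then show "x \<in> prob_vec \<iota> ` prob_measures n" using Q(1) by blast
qed

text \<open>All subsets are measurable, so a nonempty null set contains a null singleton. Applied to
  both \<open>Q\<close> and a fully supported \<open>P\<close>, this turns equivalence of measures
  into strict positivity of the weights of \<open>Q\<close>.\<close>

lemma null_sets_eq_empty_iff:
  assumes Q: "Q \<in> prob_measures n"
  shows "null_sets Q = {{}} \<longleftrightarrow> (\<forall>i\<in>{1..n}. 0 < measure Q {i})"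
proof -
  interpret prob_space Q using Q by (simp add: prob_measures_def)
  have sets: "sets Q = Pow {1..n}" using Q by (simp add: prob_measures_def)
  have null: "{i} \<in> null_sets Q \<longleftrightarrow> measure Q {i} = 0" if "i \<in> {1..n}" for i
    using that sets by (simp add: null_sets_def emeasure_eq_measure)
  show ?thesis
  proof
    assume "null_sets Q = {{}}"
    then show "\<forall>i\<in>{1..n}. 0 < measure Q {i}"
      using null by (auto simp: zero_less_measure_iff)
  next
    assume pos: "\<forall>i\<in>{1..n}. 0 < measure Q {i}"
    have "A = {}" if A: "A \<in> null_sets Q" for A
    proof (rule ccontr)
      assume "A \<noteq> {}"
      then obtain i where i: "i \<in> A" by blast
      have "A \<subseteq> {1..n}" using A sets by (auto simp: null_sets_def)
      then have "{i} \<in> null_sets Q" "i \<in> {1..n}"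
        using i A sets null_sets_subset[of A Q "{i}"] by auto
      then show False using null pos by force
    qed
    then show "null_sets Q = {{}}" by auto
  qed
qed

text \<open>The expected price is \<open>S0\<close> times the mean of the price relatives, so
  \<open>S0\<close> cancels and the martingale condition says that this mean is
  \<open>1 + r\<close>. Equivalence to \<open>P\<close> becomes positivity of all entries.\<close>

lemma prob_vec_image_emm:
  fixes \<iota> :: "'n::finite \<Rightarrow> nat"
  assumes \<iota>: "bij_betw \<iota> UNIV {1..n}" and "1 + r > 0" "S0 > 0"
    and P: "P \<in> prob_measures n" "\<forall>i\<in>{1..n}. measure P {i} > 0"
  shows "prob_vec \<iota> ` emm n P S0 m r
    = {x \<in> mart_weights (\<lambda>k. m (\<iota> k)) (1 + r). \<forall>k. 0 < x $ k}"
proof -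
  have "Q \<in> emm n P S0 m r \<longleftrightarrow> (\<Sum>k\<in>UNIV. m (\<iota> k) * prob_vec \<iota> Q $ k) = 1 + r
      \<and> (\<forall>k. 0 < prob_vec \<iota> Q $ k)" if Q: "Q \<in> prob_measures n" for Q
  proof -
    have "integral\<^sup>L Q (stock_price S0 m) = (\<Sum>i\<in>{1..n}. m i * measure Q {i}) * S0"
      unfolding prob_measures_integral[OF Q] sum_distrib_right
      by (intro sum.cong) (simp_all add: stock_price_def)
    also have "(\<Sum>i\<in>{1..n}. m i * measure Q {i}) = (\<Sum>k\<in>UNIV. m (\<iota> k) * prob_vec \<iota> Q $ k)"
      using sum.reindex_bij_betw[OF \<iota>, of "\<lambda>i. m i * measure Q {i}"] by (simp add: prob_vec_def)
    finally have "inverse (1 + r) * integral\<^sup>L Q (stock_price S0 m) = S0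
        \<longleftrightarrow> (\<Sum>k\<in>UNIV. m (\<iota> k) * prob_vec \<iota> Q $ k) = 1 + r"
      using assms(2,3) by (simp add: inverse_eq_divide divide_eq_eq mult.commute[of S0])
    moreover have "equiv_measures Q P \<longleftrightarrow> (\<forall>i\<in>{1..n}. 0 < measure Q {i})"
      using null_sets_eq_empty_iff[OF Q] null_sets_eq_empty_iff[OF P(1)] P(2)
      by (simp add: equiv_measures_def)
    moreover have "\<dots> \<longleftrightarrow> (\<forall>k. 0 < prob_vec \<iota> Q $ k)"
      unfolding bij_betw_imp_surj_on[OF \<iota>, symmetric] by (simp add: prob_vec_def)
    ultimately show ?thesis using Q by (simp add: emm_def)
  qed
  moreover have "emm n P S0 m r \<subseteq> prob_measures n" by (auto simp: emm_def)
  ultimately have "prob_vec \<iota> ` emm n P S0 m r = {x \<in> prob_vec \<iota> ` prob_measures n.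
      (\<Sum>k\<in>UNIV. m (\<iota> k) * x $ k) = 1 + r \<and> (\<forall>k. 0 < x $ k)}"
    by blast
  then show ?thesis
    unfolding prob_vec_image_prob_measures[OF \<iota>] by (auto simp: mart_weights_def)
qed

section \<open>Return to the market model\<close>

lemma q_vec_eq_two_point:
  assumes "inj \<iota>"
  shows "q_vec \<iota> m r (\<iota> i) (\<iota> j) = two_point (\<lambda>k. m (\<iota> k)) (1 + r) i j"
  using assms by (auto simp: q_vec_def two_point_def vec_eq_iff inj_eq)

theorem theorem1:
  fixes n s :: nat and m :: "nat \<Rightarrow> real" and r S0 :: real
    and P :: "nat measure" and \<iota> :: "'n::finite \<Rightarrow> nat"
  assumes coords: "bij_betw \<iota> UNIV {1..n}"
    and n: "n > 2"
    and m_decreasing: "strict_antimono_on {1..n} m"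
    and m_pos: "m n > 0"
    and R_pos: "1 + r > 0"
    and S0_pos: "S0 > 0"
    and P_prob: "P \<in> prob_measures n"
    and P_pos: "\<forall>i\<in>{1..n}. measure P {i} > 0"
    and s: "s \<in> {2..n}"
    and upper: "m (s - 1) > 1 + r"
    and lower: "1 + r \<ge> m s"
    and not_last: "1 + r \<noteq> m n"
  shows "(\<forall>i\<in>{1..s-1}. \<forall>j\<in>{s..n}. \<exists>Q\<in>prob_measures n. prob_vec \<iota> Q = q_vec \<iota> m r i j) \<and>
    {x. x extreme_point_of closure (prob_vec \<iota> ` emm n P S0 m r)} =
      {q_vec \<iota> m r i j | i j. (i, j) \<in> {1..s-1} \<times> {s..n}}"
proof -
  let ?a = "\<lambda>k. m (\<iota> k)" and ?R = "1 + r"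
  have inj: "inj \<iota>" and range: "range \<iota> = {1..n}" using coords by (auto simp: bij_betw_def)
  have mono: "m j \<le> m i" if "i \<in> {1..n}" "j \<in> {1..n}" "i \<le> j" for i j
    using monotone_onD[OF m_decreasing that(1,2)] that(3) by (cases "i = j") auto
  \<comment> \<open>Monotonicity carries the inequalities at \<open>s - 1\<close> and
    \<open>s\<close> to all outcomes, so the two index sets are exactly the outcomes above
    \<open>1 + r\<close> and those at or below it.\<close>
  have I: "i \<in> {1..s-1} \<longleftrightarrow> ?R < m i" and J: "i \<in> {s..n} \<longleftrightarrow> m i \<le> ?R" if "i \<in> {1..n}" for i
  proof -
    have "?R < m i" if "i \<le> s - 1" using mono[of i "s - 1"] \<open>i \<in> {1..n}\<close> that s upper by force
    moreover have "m i \<le> ?R" if "s \<le> i" using mono[of s i] \<open>i \<in> {1..n}\<close> that s lower by auto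
    moreover have "i \<le> s - 1 \<or> s \<le> i" by linarith
    ultimately show "i \<in> {1..s-1} \<longleftrightarrow> ?R < m i" "i \<in> {s..n} \<longleftrightarrow> m i \<le> ?R"
      using \<open>i \<in> {1..n}\<close> s by (auto simp: not_less dest: leD)
  qed
  let ?L = "{q_vec \<iota> m r i j | i j. (i, j) \<in> {1..s-1} \<times> {s..n}}"
  let ?T = "{two_point ?a ?R i j | i j. ?R < ?a i \<and> ?a j \<le> ?R}"
  have q_vecs: "?L = ?T"
  proof (intro equalityI subsetI)
    fix x assume "x \<in> ?L"
    then obtain i j where ij: "i \<in> {1..s-1}" "j \<in> {s..n}" "x = q_vec \<iota> m r i j" by blast
    then have "i \<in> {1..n}" "j \<in> {1..n}" using s by auto
    moreover from this obtain k l where "i = \<iota> k" "j = \<iota> l" using range by (metis imageE)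
    ultimately show "x \<in> ?T" using ij I J q_vec_eq_two_point[OF inj] by blast
  next
    fix x assume "x \<in> ?T"
    then obtain k l where "?R < ?a k" "?a l \<le> ?R" "x = two_point ?a ?R k l" by blast
    moreover have "\<iota> k \<in> {1..n}" "\<iota> l \<in> {1..n}" using range by auto
    ultimately show "x \<in> ?L" using I J q_vec_eq_two_point[OF inj, of m r k l, symmetric] by blast
  qed
  \<comment> \<open>The outcomes \<open>s - 1\<close> and \<open>n\<close> provide coordinates with
    values strictly above and strictly below \<open>1 + r\<close>, as the density argument requires;
    strictness at \<open>n\<close> comes from \<open>not_last\<close>.\<close>
  have "s - 1 \<in> range \<iota>" "n \<in> range \<iota>" using range s by auto
  then obtain h l where hl: "\<iota> h = s - 1" "\<iota> l = n" by (metis imageE)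
  have "m n < ?R" using J[of n] s not_last by auto
  then have high: "?R < ?a h" and low: "?a l < ?R" using hl upper by simp_all
  have "closure (prob_vec \<iota> ` emm n P S0 m r) = mart_weights ?a ?R"
    using prob_vec_image_emm[OF coords R_pos S0_pos P_prob P_pos]
      closure_positive_mart_weights[where a = ?a and h = h and l = l, OF high low] by simp
  then have ext: "{x. x extreme_point_of closure (prob_vec \<iota> ` emm n P S0 m r)}
      = ?L"
    using extreme_points_mart_weights[where a = ?a and l = h, OF high] q_vecs by simp
  \<comment> \<open>Martingale weights lie in the standard simplex, which is the image of the
    probability measures; hence every \<open>q_vec\<close> in question comes from a measure.\<close>
  have "?T \<subseteq> mart_weights ?a ?R" using two_point_in_mart_weights[of ?R ?a] by blast
  also have "\<dots> \<subseteq> prob_vec \<iota> ` prob_measures n"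
    unfolding prob_vec_image_prob_measures[OF coords] by (auto simp: mart_weights_def)
  finally have "?L \<subseteq> prob_vec \<iota> ` prob_measures n" using q_vecs by simp
  then have "\<forall>i\<in>{1..s-1}. \<forall>j\<in>{s..n}. \<exists>Q\<in>prob_measures n. prob_vec \<iota> Q = q_vec \<iota> m r i j"
    by (fastforce simp: image_iff)
  with ext show ?thesis by blast
qed

end
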